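(* Assume $S(a_i,b_i)\ne\emptyset$ for every $i\in I$. Then $S(A,b)\neq\emptyset$ if and only if $\overline{X}\in S(A,b)$.
   Context: Let $I=\{1,\dots,m\}$ and $J=\{1,\dots,n\}$ with $m,n\ge 1$. Let $A=(a_{ij})_{m\times n}$ be a matrix with entries in $[0,1]$ with $i$-th row $a_i$, and let $b=(b_i)_{m\times 1}$ be a vector with entries in $[0,1]$. Let $w\in(0,1)$ and $p>0$ be real numbers. For $x,y\in[0,1]$ put $\varphi(x,y)=\left(w x^{p}+(1-w)y^{p}\right)^{1/p}$ (weighted power mean). For $x\in[0,1]^n$ put $\varphi(a_i,x)=\max_{j\in J}\varphi(a_{ij},x_j)$, let $S(a_i,b_i)=\{x\in[0,1]^n:\varphi(a_i,x)=b_i\}$ and $S(A,b)=\bigcap_{i\in I}S(a_i,b_i)$. For $i\in I$ define $J^{-}(i)=\{j\in J: a_{ij}>b_i/\sqrt[p]{w}\}$, $J^{\infty}(i)=\{j\in J: b_i^{p}\ge 1-w,\ a_{ij}<[(b_i^{p}+w-1)/w]^{1/p}\}$ and $J(i)=J\setminus(J^{-}(i)\cup J^{\infty}(i))$. When $S(a_i,b_i)\neq\emptyset$ (in which case $J^{-}(i)=\emptyset$), define $\overline{X}(i)\in[0,1]^n$ by $\overline{X}(i)_j=\left(\frac{b_i^{p}-w a_{ij}^{p}}{1-w}\right)^{1/p}$ if $j\in J(i)$ and $\overline{X}(i)_j=1$ if $j\in J^{\infty}(i)$. Let $\overline{X}=\min_{i\in I}\overline{X}(i)$ (componentwise minimum).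 *)

theory Defs
  imports "HOL-Analysis.Analysis"
begin

text \<open>
  The index sets $I$ and $J$ are the finite (nonempty) types \<open>'m\<close> and \<open>'n\<close>. All powers have a
  nonnegative base wherever they are relevant; \<open>0 powr q = 0\<close> is then the right convention,
  the exponents \<open>p\<close> and \<open>1 / p\<close> being positive.
\<close>

definition pmean :: "real \<Rightarrow> real \<Rightarrow> real \<Rightarrow> real \<Rightarrow> real" where
  "pmean w p x y = (w * x powr p + (1 - w) * y powr p) powr (1 / p)"

definition unit_cube :: "(real ^ 'n) set" where
  "unit_cube = {x. \<forall>j. x $ j \<in> {0..1}}"

definition max_comp :: "real \<Rightarrow> real \<Rightarrow> real ^ 'n \<Rightarrow> real ^ 'n \<Rightarrow> real" where
  "max_comp w p a x = (MAX j. pmean w p (a $ j) (x $ j))"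

definition row_solutions :: "real \<Rightarrow> real \<Rightarrow> real ^ 'n \<Rightarrow> real \<Rightarrow> (real ^ 'n) set" where
  "row_solutions w p a \<beta> = {x \<in> unit_cube. max_comp w p a x = \<beta>}"

definition solutions :: "real \<Rightarrow> real \<Rightarrow> real ^ 'n ^ 'm \<Rightarrow> real ^ 'm \<Rightarrow> (real ^ 'n) set" where
  "solutions w p A b = (\<Inter>i. row_solutions w p (A $ i) (b $ i))"

definition J_minus :: "real \<Rightarrow> real \<Rightarrow> real ^ 'n ^ 'm \<Rightarrow> real ^ 'm \<Rightarrow> 'm \<Rightarrow> 'n set" where
  "J_minus w p A b i = {j. A $ i $ j > b $ i / w powr (1 / p)}"

definition J_infty :: "real \<Rightarrow> real \<Rightarrow> real ^ 'n ^ 'm \<Rightarrow> real ^ 'm \<Rightarrow> 'm \<Rightarrow> 'n set" where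
  "J_infty w p A b i =
     {j. (b $ i) powr p \<ge> 1 - w \<and>
         A $ i $ j < (((b $ i) powr p + w - 1) / w) powr (1 / p)}"

definition J_set :: "real \<Rightarrow> real \<Rightarrow> real ^ 'n ^ 'm \<Rightarrow> real ^ 'm \<Rightarrow> 'm \<Rightarrow> 'n set" where
  "J_set w p A b i = UNIV - (J_minus w p A b i \<union> J_infty w p A b i)"

text \<open>
  The last branch concerns only \<open>j \<in> J_minus w p A b i\<close>, a set which is empty
  whenever row \<open>i\<close> is solvable.
\<close>

definition X_bar_row :: "real \<Rightarrow> real \<Rightarrow> real ^ 'n ^ 'm \<Rightarrow> real ^ 'm \<Rightarrow> 'm \<Rightarrow> real ^ 'n" where
  "X_bar_row w p A b i =
     (\<chi> j. if j \<in> J_set w p A b i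
           then (((b $ i) powr p - w * (A $ i $ j) powr p) / (1 - w)) powr (1 / p)
           else if j \<in> J_infty w p A b i then 1
           else undefined)"

definition X_bar :: "real \<Rightarrow> real \<Rightarrow> real ^ 'n ^ 'm \<Rightarrow> real ^ 'm \<Rightarrow> real ^ 'n" where
  "X_bar w p A b = (\<chi> j. MIN i. X_bar_row w p A b i $ j)"

end

theory Submission
  imports Defs
begin

text \<open>
  The reason behind the theorem is that \<open>X_bar\<close> is the greatest solution of the system of
  inequalities \<open>max_comp w p (A $ i) x \<le> b $ i\<close> in the unit cube. For a single entry,
  solving \<open>pmean w p a x \<le> \<beta>\<close> for \<open>x\<close> gives an upper bound on \<open>x\<close>, namely
  \<open>((\<beta> powr p - w * a powr p) / (1 - w)) powr (1 / p)\<close>; the set \<open>J_infty\<close> collects the indices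
  where this bound exceeds \<open>1\<close> and so is no restriction in the cube. Solvability of the single
  rows makes the base of the power nonnegative and \<open>J_minus\<close> empty. Hence \<open>X_bar_row\<close> is the
  minimum of this bound and \<open>1\<close> (\<open>X_bar_row_eq_min\<close>), and a point of the cube satisfies all
  inequalities exactly when it lies below \<open>X_bar\<close> (\<open>max_comp_le_iff_le_X_bar\<close>).

  Given any solution \<open>x\<close> of the equations, therefore \<open>x \<le> X_bar\<close>, and monotonicity squeezes
  \<open>b $ i = max_comp w p (A $ i) x \<le> max_comp w p (A $ i) (X_bar w p A b) \<le> b $ i\<close>.
\<close>

lemma powr_inverse_le_iff:
  fixes s \<beta> p :: real
  assumes "p > 0" "s \<ge> 0" "\<beta> \<ge> 0"
  shows "s powr (1 / p) \<le> \<beta> \<longleftrightarrow> s \<le> \<beta> powr p"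
proof
  assume "s powr (1 / p) \<le> \<beta>"
  then have "(s powr (1 / p)) powr p \<le> \<beta> powr p"
    using assms by (intro powr_mono2) auto
  then show "s \<le> \<beta> powr p"
    using assms by (simp add: powr_powr)
next
  assume "s \<le> \<beta> powr p"
  then have "s powr (1 / p) \<le> (\<beta> powr p) powr (1 / p)"
    using assms by (intro powr_mono2) auto
  then show "s powr (1 / p) \<le> \<beta>"
    using assms by (simp add: powr_powr)
qed

lemma le_powr_inverse_iff:
  fixes s \<beta> p :: real
  assumes "p > 0" "s \<ge> 0" "\<beta> \<ge> 0"
  shows "\<beta> \<le> s powr (1 / p) \<longleftrightarrow> \<beta> powr p \<le> s"
  using powr_inverse_le_iff[of "1 / p" \<beta> s] assms by simp

lemma pmean_le_iff:
  assumes "0 < w" "w < 1" "p > 0" "\<beta> \<ge> 0"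
  shows "pmean w p a x \<le> \<beta> \<longleftrightarrow> w * a powr p + (1 - w) * x powr p \<le> \<beta> powr p"
  unfolding pmean_def using assms by (intro powr_inverse_le_iff) auto

lemma pmean_mono:
  assumes "0 < w" "w < 1" "p > 0" "0 \<le> x" "x \<le> y"
  shows "pmean w p a x \<le> pmean w p a y"
  unfolding pmean_def using assms
  by (intro powr_mono2 add_left_mono mult_left_mono) auto

lemma max_comp_le_iff: "max_comp w p a x \<le> \<beta> \<longleftrightarrow> (\<forall>j. pmean w p (a $ j) (x $ j) \<le> \<beta>)"
  unfolding max_comp_def by (subst Max_le_iff) auto

lemma max_comp_mono:
  assumes "0 < w" "w < 1" "p > 0" "\<And>j. 0 \<le> x $ j" "\<And>j. x $ j \<le> y $ j"
  shows "max_comp w p a x \<le> max_comp w p a y"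
proof -
  have "\<forall>j. pmean w p (a $ j) (y $ j) \<le> max_comp w p a y"
    using max_comp_le_iff by blast
  then show ?thesis
    using assms pmean_mono order_trans unfolding max_comp_le_iff by metis
qed

text \<open>
  Since the term \<open>(1 - w) * x powr p\<close> is nonnegative, a solution of the row forces
  this inequality on its coefficients; it makes the base of the upper bound nonnegative, so
  that the bound can be compared with \<open>x\<close> by taking powers.
\<close>

lemma row_solvable_imp_weighted_le:
  assumes "0 < w" "w < 1" "p > 0" "\<beta> \<ge> 0" "row_solutions w p a \<beta> \<noteq> {}"
  shows "w * (a $ j) powr p \<le> \<beta> powr p"
proof -
  obtain x where "max_comp w p a x = \<beta>"
    using assms by (auto simp: row_solutions_def)
  then have "pmean w p (a $ j) (x $ j) \<le> \<beta>"
    using max_comp_le_iff by (metis order_refl)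
  then have "w * (a $ j) powr p + (1 - w) * (x $ j) powr p \<le> \<beta> powr p"
    using assms by (simp add: pmean_le_iff)
  moreover have "0 \<le> (1 - w) * (x $ j) powr p"
    using assms by simp
  ultimately show ?thesis by linarith
qed

lemma row_solvable_imp_J_minus_empty:
  assumes "0 < w" "w < 1" "p > 0" "b $ i \<ge> 0" "A $ i $ j \<ge> 0"
    and "row_solutions w p (A $ i) (b $ i) \<noteq> {}"
  shows "j \<notin> J_minus w p A b i"
proof -
  have "(A $ i $ j) powr p \<le> (b $ i) powr p / w"
    using row_solvable_imp_weighted_le[of w p "b $ i" "A $ i" j] assms
    by (simp add: field_simps)
  then have "A $ i $ j \<le> ((b $ i) powr p / w) powr (1 / p)"
    using assms by (subst le_powr_inverse_iff) auto
  also have "\<dots> = b $ i / w powr (1 / p)"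
    using assms by (simp add: powr_divide powr_powr)
  finally show ?thesis by (simp add: J_minus_def)
qed

text \<open>
  The two conditions defining \<open>J_infty\<close> say together that the upper bound exceeds \<open>1\<close>. The first
  keeps the base of the second power nonnegative; if it fails, then
  \<open>\<beta> powr p / (1 - w) < 1\<close> already bounds the quotient.
\<close>

lemma mem_J_infty_iff:
  assumes "0 < w" "w < 1" "p > 0" "A $ i $ j \<ge> 0"
  shows "j \<in> J_infty w p A b i \<longleftrightarrow>
         1 < ((b $ i) powr p - w * (A $ i $ j) powr p) / (1 - w)"
proof (cases "(b $ i) powr p \<ge> 1 - w")
  case True
  let ?s = "((b $ i) powr p + w - 1) / w"
  have "j \<in> J_infty w p A b i \<longleftrightarrow> \<not> (?s powr (1 / p) \<le> A $ i $ j)"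
    using True by (auto simp: J_infty_def)
  also have "\<dots> \<longleftrightarrow> \<not> (?s \<le> (A $ i $ j) powr p)"
    using True assms by (subst powr_inverse_le_iff) auto
  also have "\<dots> \<longleftrightarrow> 1 < ((b $ i) powr p - w * (A $ i $ j) powr p) / (1 - w)"
    using assms by (auto simp: field_simps)
  finally show ?thesis .
next
  case False
  moreover have "0 \<le> w * (A $ i $ j) powr p"
    using assms by simp
  ultimately have "(b $ i) powr p - w * (A $ i $ j) powr p < 1 - w"
    by linarith
  then show ?thesis
    using False assms by (simp add: J_infty_def less_divide_eq)
qed

lemma X_bar_row_eq_min:
  fixes A :: "real ^ 'n ^ 'm"
  assumes "0 < w" "w < 1" "p > 0" "b $ i \<ge> 0" "A $ i $ j \<ge> 0"
    and "row_solutions w p (A $ i) (b $ i) \<noteq> {}"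
  shows "X_bar_row w p A b i $ j =
         min 1 ((((b $ i) powr p - w * (A $ i $ j) powr p) / (1 - w)) powr (1 / p))"
proof -
  let ?t = "((b $ i) powr p - w * (A $ i $ j) powr p) / (1 - w)"
  have t: "0 \<le> ?t"
    using row_solvable_imp_weighted_le[of w p "b $ i" "A $ i" j] assms by simp
  have not_minus: "j \<notin> J_minus w p A b i"
    using row_solvable_imp_J_minus_empty assms by blast
  have "j \<in> J_infty w p A b i \<longleftrightarrow> \<not> ?t powr (1 / p) \<le> 1"
    using powr_inverse_le_iff[of p ?t 1] mem_J_infty_iff[of w p A i j b] t assms by auto
  then show ?thesis
    using not_minus by (auto simp: X_bar_row_def J_set_def)
qed

lemma pmean_le_iff_le_X_bar_row:
  fixes A :: "real ^ 'n ^ 'm"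
  assumes "0 < w" "w < 1" "p > 0" "b $ i \<ge> 0" "A $ i $ j \<ge> 0"
    and "row_solutions w p (A $ i) (b $ i) \<noteq> {}" and "0 \<le> x" "x \<le> 1"
  shows "pmean w p (A $ i $ j) x \<le> b $ i \<longleftrightarrow> x \<le> X_bar_row w p A b i $ j"
proof -
  let ?t = "((b $ i) powr p - w * (A $ i $ j) powr p) / (1 - w)"
  have t: "0 \<le> ?t"
    using row_solvable_imp_weighted_le[of w p "b $ i" "A $ i" j] assms by simp
  have "pmean w p (A $ i $ j) x \<le> b $ i \<longleftrightarrow> x powr p \<le> ?t"
    using assms by (simp add: pmean_le_iff field_simps)
  also have "\<dots> \<longleftrightarrow> x \<le> ?t powr (1 / p)"
    using le_powr_inverse_iff t assms by simp
  finally show ?thesis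
    using assms by (simp add: X_bar_row_eq_min)
qed

lemma le_X_bar_iff: "c \<le> X_bar w p A b $ j \<longleftrightarrow> (\<forall>i. c \<le> X_bar_row w p A b i $ j)"
  unfolding X_bar_def by simp

lemma X_bar_in_unit_cube:
  fixes A :: "real ^ 'n ^ 'm"
  assumes "0 < w" "w < 1" "p > 0" "\<And>i. b $ i \<ge> 0" "\<And>i j. A $ i $ j \<ge> 0"
    and "\<And>i. row_solutions w p (A $ i) (b $ i) \<noteq> {}"
  shows "X_bar w p A b \<in> unit_cube"
proof -
  have "X_bar_row w p A b i $ j \<in> {0..1}" for i j
    using assms by (simp add: X_bar_row_eq_min)
  moreover have "X_bar w p A b $ j \<le> X_bar_row w p A b i $ j" for i j
    using le_X_bar_iff by blast
  ultimately show ?thesis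
    unfolding unit_cube_def atLeastAtMost_iff mem_Collect_eq le_X_bar_iff
    by (meson order_trans)
qed

lemma max_comp_le_iff_le_X_bar:
  fixes A :: "real ^ 'n ^ 'm"
  assumes "0 < w" "w < 1" "p > 0" "\<And>i. b $ i \<ge> 0" "\<And>i j. A $ i $ j \<ge> 0"
    and "\<And>i. row_solutions w p (A $ i) (b $ i) \<noteq> {}" and "x \<in> unit_cube"
  shows "(\<forall>i. max_comp w p (A $ i) x \<le> b $ i) \<longleftrightarrow> (\<forall>j. x $ j \<le> X_bar w p A b $ j)"
proof -
  have "0 \<le> x $ j" "x $ j \<le> 1" for j
    using assms by (auto simp: unit_cube_def)
  then show ?thesis
    using assms by (auto simp: max_comp_le_iff le_X_bar_iff pmean_le_iff_le_X_bar_row)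
qed

theorem corollary2:
  fixes A :: "real ^ 'n ^ 'm" and b :: "real ^ 'm" and w p :: real
  assumes "\<And>i j. A $ i $ j \<in> {0..1}"
    and "\<And>i. b $ i \<in> {0..1}"
    and "0 < w" and "w < 1" and "p > 0"
    and "\<And>i. row_solutions w p (A $ i) (b $ i) \<noteq> {}"
  shows "solutions w p A b \<noteq> {} \<longleftrightarrow> X_bar w p A b \<in> solutions w p A b"
proof
  assume "solutions w p A b \<noteq> {}"
  then obtain x where x: "x \<in> unit_cube" "\<And>i. max_comp w p (A $ i) x = b $ i"
    by (auto simp: solutions_def row_solutions_def)
  have nonneg: "\<And>i j. A $ i $ j \<ge> 0" "\<And>i. b $ i \<ge> 0"
    using assms(1,2) by auto
  let ?X = "X_bar w p A b"
  have cube: "?X \<in> unit_cube"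
    using X_bar_in_unit_cube assms(3-) nonneg by blast
  have "\<forall>j. x $ j \<le> ?X $ j"
    using max_comp_le_iff_le_X_bar[OF assms(3-5) nonneg(2,1) assms(6) x(1)] x(2) by simp
  then have "b $ i \<le> max_comp w p (A $ i) ?X" for i
    using max_comp_mono[of w p x ?X "A $ i"] x assms(3-5) by (simp add: unit_cube_def)
  moreover have "max_comp w p (A $ i) ?X \<le> b $ i" for i
    using max_comp_le_iff_le_X_bar[OF assms(3-5) nonneg(2,1) assms(6) cube] by simp
  ultimately have "max_comp w p (A $ i) ?X = b $ i" for i
    by (intro antisym)
  then show "?X \<in> solutions w p A b"
    using cube by (auto simp: solutions_def row_solutions_def)
qed auto

end
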